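(* Linear prediction coefficients cannot distinguish signals spanned by the same set of interpolation bases. That is: let $p \ge 1$ be an integer, let $a_1,\dots,a_p$ be real numbers, and let $\mathcal{B}$ be the set of interpolation bases corresponding to the order $p$ linear prediction recurrence with coefficients $a_1,\dots,a_p$. Then the same coefficients $a_1,\dots,a_p$ represent every real signal (of finite or infinite length) spanned by $\mathcal{B}$; so any two signals $f$ and $g$ spanned by $\mathcal{B}$ both satisfy $$f_n = \sum_{k=1}^{p} a_k f_{n-k} \quad\text{and}\quad g_n = \sum_{k=1}^{p} a_k g_{n-k}$$ for all $n \ge p$ in their respective index ranges, and are not distinguished by these coefficients.
   Context: A (discrete real) signal is a sequence of real numbers $f_n$, indexed either by $n = 0,1,\dots,N-1$ (finite-length) or by all $n = 0,1,2,\dots$ (infinite-length). An order $p$ linear prediction (LP) recurrence with real coefficients $a_1,\dots,a_p$ is $f_n = \sum_{k=1}^{p} a_k f_{n-k}$, required for every $n \ge p$ in the index range; the coefficients represent the signal if the signal satisfies this recurrence. Its characteristic polynomial is $x^p - \sum_{k=1}^{p} a_k x^{p-k}$. Interpolation bases are the expressions $n^{k}\rho^{n}\cos(n\theta)$ and $n^{k}\rho^{n}\sin(n\theta)$ with $\theta,\rho$ real and $k$ a nonnegative integer (with the convention $0^0=1$). The set $\mathcal{B}$ corresponding to the recurrence consists of the following. (i) For each real root $\rho$ of the characteristic polynomial, of multiplicity $e$, the sequences $n \mapsto n^{k}\rho^{n}$ for $0 \le k \le e-1$. (ii) For each pair of non-real complex conjugate roots $\rho e^{\pm i\theta}$ ($\rho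 > 0$, $0<\theta<\pi$), each of multiplicity $e$, the sequences $n \mapsto n^{k}\rho^{n}\cos(n\theta)$ and $n \mapsto n^{k}\rho^{n}\sin(n\theta)$ for $0 \le k \le e-1$. A signal is spanned by $\mathcal{B}$ if, on its index range, it is a linear combination with real coefficients of the elements of $\mathcal{B}$. *)

theory Defs
  imports
    Complex_Main
    "HOL-Library.Extended_Nat"
    "HOL-Computational_Algebra.Polynomial"
begin

text \<open>
  A signal is a pair of a length \<open>N :: enat\<close> and a function \<open>f :: nat \<Rightarrow> real\<close>, of which only the
  values on \<open>index_range N\<close> are relevant; \<open>N = \<infinity>\<close> gives the infinite-length signals.
  Only the values \<open>a 1, \<dots>, a p\<close> of a coefficient function \<open>a :: nat \<Rightarrow> real\<close> are used.
\<close>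

definition index_range :: "enat \<Rightarrow> nat set" where
  "index_range N = {n. enat n < N}"

definition lp_represents :: "nat \<Rightarrow> (nat \<Rightarrow> real) \<Rightarrow> enat \<Rightarrow> (nat \<Rightarrow> real) \<Rightarrow> bool" where
  "lp_represents p a N f \<longleftrightarrow>
     (\<forall>n\<in>index_range N. n \<ge> p \<longrightarrow> f n = (\<Sum>k=1..p. a k * f (n - k)))"

definition lp_char_poly :: "nat \<Rightarrow> (nat \<Rightarrow> real) \<Rightarrow> real poly" where
  "lp_char_poly p a = monom 1 p - (\<Sum>k=1..p. monom (a k) (p - k))"

abbreviation lp_char_poly_complex :: "nat \<Rightarrow> (nat \<Rightarrow> real) \<Rightarrow> complex poly" where
  "lp_char_poly_complex p a \<equiv> map_poly complex_of_real (lp_char_poly p a)"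

text \<open>
  Each conjugate pair of non-real roots is given by its member \<open>rcis \<rho> \<theta>\<close> in the upper half-plane.
  The root \<open>0\<close> is allowed: it contributes the unit impulse for \<open>k = 0\<close> (as \<open>0 ^ 0 = 1\<close>)
  and the zero sequence for \<open>k > 0\<close>.
\<close>

definition interpolation_bases :: "nat \<Rightarrow> (nat \<Rightarrow> real) \<Rightarrow> (nat \<Rightarrow> real) set" where
  "interpolation_bases p a =
     {(\<lambda>n. real n ^ k * \<rho> ^ n) | k \<rho>.
        poly (lp_char_poly p a) \<rho> = 0 \<and> k < order \<rho> (lp_char_poly p a)}
   \<union> {(\<lambda>n. real n ^ k * \<rho> ^ n * cos (real n * \<theta>)) | k \<rho> \<theta>.
        \<rho> > 0 \<and> 0 < \<theta> \<and> \<theta> < pi \<and> poly (lp_char_poly_complex p a) (rcis \<rho> \<theta>) = 0 \<and>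
        k < order (rcis \<rho> \<theta>) (lp_char_poly_complex p a)}
   \<union> {(\<lambda>n. real n ^ k * \<rho> ^ n * sin (real n * \<theta>)) | k \<rho> \<theta>.
        \<rho> > 0 \<and> 0 < \<theta> \<and> \<theta> < pi \<and> poly (lp_char_poly_complex p a) (rcis \<rho> \<theta>) = 0 \<and>
        k < order (rcis \<rho> \<theta>) (lp_char_poly_complex p a)}"

definition spanned_by :: "enat \<Rightarrow> (nat \<Rightarrow> real) \<Rightarrow> (nat \<Rightarrow> real) set \<Rightarrow> bool" where
  "spanned_by N f B \<longleftrightarrow>
     (\<exists>S c. finite S \<and> S \<subseteq> B \<and> (\<forall>n\<in>index_range N. f n = (\<Sum>b\<in>S. c b * b n)))"

text \<open>Coefficients distinguish two signals if they represent exactly one of them.\<close>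

definition lp_distinguishes ::
  "nat \<Rightarrow> (nat \<Rightarrow> real) \<Rightarrow> enat \<Rightarrow> (nat \<Rightarrow> real) \<Rightarrow> enat \<Rightarrow> (nat \<Rightarrow> real) \<Rightarrow> bool" where
  "lp_distinguishes p a N f M g \<longleftrightarrow> lp_represents p a N f \<noteq> lp_represents p a M g"

end

theory Submission
  imports Defs
begin

text \<open>
  The sum \<open>\<Sum>\<^sub>i q\<^sub>i i\<^sup>k z\<^sup>i\<close> is the value at \<open>z\<close> of the polynomial obtained from \<open>q\<close> by applying \<open>k\<close>
  times the Euler operator \<open>x d/dx\<close>, which lowers the multiplicity of a root by at most one. For
  \<open>n \<ge> p\<close>, take \<open>q\<close> to be \<open>x\<^sup>n\<^sup>-\<^sup>p\<close> times the characteristic polynomial: if \<open>z\<close> is a root of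
  multiplicity exceeding \<open>k\<close>, the vanishing of this sum is the recurrence for \<open>n\<^sup>k z\<^sup>n\<close>. Real and
  imaginary parts give the cosine and sine bases.
\<close>

definition euler_op :: "'a::idom poly \<Rightarrow> 'a poly" where
  "euler_op q = pCons 0 (pderiv q)"

lemma coeff_euler_op_funpow:
  "coeff ((euler_op ^^ k) q) i = of_nat i ^ k * coeff q i"
  by (induction k) (auto simp: euler_op_def coeff_pCons coeff_pderiv split: nat.splits)

text \<open>By the product rule, both summands of the derivative of
  \<open>[:- z, 1:] ^ Suc j * r\<close> keep the factor \<open>[:- z, 1:] ^ j\<close>.\<close>

lemma power_dvd_euler_op:
  fixes z :: "'a::idom"
  assumes "[:- z, 1:] ^ Suc j dvd q"
  shows "[:- z, 1:] ^ j dvd euler_op q"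
proof -
  obtain r where q: "q = [:- z, 1:] ^ Suc j * r"
    using assms by (elim dvdE)
  have "[:- z, 1:] ^ j dvd pderiv q"
    unfolding q pderiv_mult pderiv_power_Suc
    by (intro dvd_add dvd_mult2[OF le_imp_power_dvd] dvd_mult[OF dvd_mult2] dvd_smult) simp_all
  moreover have "euler_op q = [:0, 1:] * pderiv q"
    by (simp add: euler_op_def)
  ultimately show ?thesis
    by (metis dvd_mult)
qed

text \<open>Each application spends one linear factor, so the induction on \<open>k\<close> uses its
  hypothesis at \<open>Suc j\<close>.\<close>

lemma power_dvd_euler_op_funpow:
  fixes z :: "'a::idom"
  assumes "[:- z, 1:] ^ (k + j) dvd q"
  shows "[:- z, 1:] ^ j dvd (euler_op ^^ k) q"
  using assms
proof (induction k arbitrary: j)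
  case (Suc k)
  then have "[:- z, 1:] ^ Suc j dvd (euler_op ^^ k) q"
    by (simp del: power_Suc)
  then show ?case
    by (simp add: power_dvd_euler_op del: power_Suc)
qed simp

lemma sum_coeff_power_eq_0:
  fixes z :: "'a::idom"
  assumes "[:- z, 1:] ^ Suc k dvd q" and "degree q \<le> n"
  shows "(\<Sum>i\<le>n. coeff q i * (of_nat i ^ k * z ^ i)) = 0"
proof -
  let ?r = "(euler_op ^^ k) q"
  have "[:- z, 1:] ^ 1 dvd ?r"
    using assms(1) by (intro power_dvd_euler_op_funpow) simp
  then have "poly ?r z = 0"
    by (simp add: poly_eq_0_iff_dvd)
  \<comment> \<open>The operator only rescales coefficients, so summing up to \<open>n\<close>
    merely adds zero terms.\<close>
  moreover have "degree ?r \<le> n"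
    using assms(2) by (intro degree_le) (auto simp: coeff_euler_op_funpow coeff_eq_0)
  then have "poly ?r z = (\<Sum>i\<le>n. coeff ?r i * z ^ i)"
    unfolding poly_altdef by (intro sum.mono_neutral_left) (auto simp: coeff_eq_0)
  ultimately show ?thesis
    by (simp add: coeff_euler_op_funpow mult_ac)
qed

lemma map_poly_lp_char_poly:
  "map_poly of_real (lp_char_poly p a) =
     (monom 1 p - (\<Sum>k=1..p. monom (of_real (a k)) (p - k)) :: 'a::real_field poly)"
  by (rule poly_eqI) (auto simp: lp_char_poly_def coeff_map_poly coeff_sum intro!: sum.cong)

text \<open>An arbitrary \<open>real_field\<close> covers real roots over the reals and non-real
  roots over the complex numbers in one proof.\<close>

lemma root_power_satisfies_recurrence:
  fixes z :: "'a::real_field"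
  assumes k: "k < order z (map_poly of_real (lp_char_poly p a))" and n: "p \<le> n"
  defines "g \<equiv> \<lambda>n. of_nat n ^ k * z ^ n"
  shows "g n = (\<Sum>j=1..p. of_real (a j) * g (n - j))"
proof -
  define P :: "'a poly" where "P = map_poly of_real (lp_char_poly p a)"
  \<comment> \<open>This is \<open>monom 1 (n - p) * P\<close> expanded: its exponents
    \<open>n - j\<close> are the indices in the recurrence at \<open>n\<close>.\<close>
  define Q where "Q = monom 1 n - (\<Sum>j=1..p. monom (of_real (a j)) (n - j) :: 'a poly)"
  have "Q = monom 1 (n - p) * P"
    unfolding P_def Q_def map_poly_lp_char_poly
    using n by (auto simp: right_diff_distrib sum_distrib_left mult_monom intro!: sum.cong)
  moreover have "[:- z, 1:] ^ Suc k dvd P"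
    using k by (intro power_le_dvd[OF order_1]) (simp add: P_def)
  ultimately have "[:- z, 1:] ^ Suc k dvd Q"
    by (metis dvd_mult)
  moreover have "degree Q \<le> n"
    unfolding Q_def
    by (intro degree_diff_le degree_sum_le) (auto intro: order_trans[OF degree_monom_le])
  ultimately have "(\<Sum>i\<le>n. coeff Q i * g i) = 0"
    unfolding g_def by (rule sum_coeff_power_eq_0)
  \<comment> \<open>Pairing coefficients with \<open>g\<close> is linear and sends the monomial of
    degree \<open>j\<close> to \<open>g j\<close>, so it turns \<open>Q\<close> into the
    recurrence.\<close>
  moreover have "(\<Sum>i\<le>n. coeff (monom c j) i * g i) = c * g j" if "j \<le> n" for c j
    using that by (simp add: if_distrib[of "\<lambda>x. x * _"] cong: if_cong)
  then have "(\<Sum>i\<le>n. coeff Q i * g i) = g n - (\<Sum>j=1..p. of_real (a j) * g (n - j))"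
    unfolding Q_def
    by (simp add: coeff_sum left_diff_distrib sum_subtractf sum_distrib_right
        sum.swap[of _ _ "{..n}"] del: coeff_monom)
  ultimately show ?thesis
    by simp
qed

lemma interpolation_basis_satisfies_recurrence:
  assumes b: "b \<in> interpolation_bases p a" and n: "p \<le> n"
  shows "b n = (\<Sum>j=1..p. a j * b (n - j))"
proof -
  \<comment> \<open>De Moivre's formula exhibits the cosine and sine bases as real and imaginary
    parts.\<close>
  have rcis: "of_nat m ^ k * rcis r t ^ m = of_real (real m ^ k) * rcis (r ^ m) (real m * t)"
    for m k r t
    by (simp add: DeMoivre2)
  consider
    (real) k r where "b = (\<lambda>n. real n ^ k * r ^ n)" "k < order r (lp_char_poly p a)"
  | (cos) k r t where "b = (\<lambda>n. real n ^ k * r ^ n * cos (real n * t))"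
      "k < order (rcis r t) (lp_char_poly_complex p a)"
  | (sin) k r t where "b = (\<lambda>n. real n ^ k * r ^ n * sin (real n * t))"
      "k < order (rcis r t) (lp_char_poly_complex p a)"
    using b unfolding interpolation_bases_def by blast
  then show ?thesis
  proof cases
    case real
    then show ?thesis
      using root_power_satisfies_recurrence[of k r p a n] n
      by (simp add: map_poly_idI)
  next
    case cos
    show ?thesis
      \<comment> \<open>The coefficients \<open>a j\<close> are real, so \<open>Re\<close> passes
        through the recurrence; likewise \<open>Im\<close> below.\<close>
      using arg_cong[OF root_power_satisfies_recurrence[OF cos(2) n], of Re]
      unfolding rcis cos(1) by (simp add: mult.assoc)
  next
    case sin
    show ?thesis
      using arg_cong[OF root_power_satisfies_recurrence[OF sin(2) n], of Im]
      unfolding rcis sin(1) by (simp add: mult.assoc)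
  qed
qed

lemma spanned_by_interpolation_bases_lp_represents:
  assumes "spanned_by N f (interpolation_bases p a)"
  shows "lp_represents p a N f"
  unfolding lp_represents_def
proof (intro ballI impI)
  fix n assume n: "n \<in> index_range N" "p \<le> n"
  obtain S c where S: "S \<subseteq> interpolation_bases p a"
    and f: "\<And>m. m \<in> index_range N \<Longrightarrow> f m = (\<Sum>b\<in>S. c b * b m)"
    using assms unfolding spanned_by_def by blast
  \<comment> \<open>Index ranges are initial segments, so the expansion of \<open>f\<close> also
    holds at the earlier indices.\<close>
  have range: "n - j \<in> index_range N" for j
    using n(1) by (auto simp: index_range_def intro: le_less_trans[of _ "enat n"])
  have "f n = (\<Sum>b\<in>S. c b * (\<Sum>j=1..p. a j * b (n - j)))"
    unfolding f[OF n(1)] using S n(2)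
    by (intro sum.cong) (auto simp: interpolation_basis_satisfies_recurrence)
  also have "\<dots> = (\<Sum>j=1..p. a j * (\<Sum>b\<in>S. c b * b (n - j)))"
    by (simp add: sum_distrib_left sum.swap[of _ S] mult_ac)
  finally show "f n = (\<Sum>j=1..p. a j * f (n - j))"
    by (simp add: f range)
qed

theorem theorem2:
  fixes p :: nat and a :: "nat \<Rightarrow> real"
  assumes "p \<ge> 1"
  shows "(\<forall>N f. spanned_by N f (interpolation_bases p a) \<longrightarrow> lp_represents p a N f) \<and>
         (\<forall>N f M g.
            spanned_by N f (interpolation_bases p a) \<and> spanned_by M g (interpolation_bases p a) \<longrightarrow>
            (\<forall>n\<in>index_range N. n \<ge> p \<longrightarrow> f n = (\<Sum>k=1..p. a k * f (n - k))) \<and>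
            (\<forall>n\<in>index_range M. n \<ge> p \<longrightarrow> g n = (\<Sum>k=1..p. a k * g (n - k))) \<and>
            \<not> lp_distinguishes p a N f M g)"
  using spanned_by_interpolation_bases_lp_represents[of _ _ p a]
  unfolding lp_distinguishes_def lp_represents_def by blast

end
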